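(* For every $n\ge 2$ there is a bijective correspondence between UM vectors of length $n-1$ and unimodal Motzkin paths with $n$ steps. Consequently, for every $n\ge 1$ there are $2^{n}$ UM vectors of length $n$.
   Context: For $\pi\in\mathfrak{S}_n$ with permutation matrix $(\pi_{a,b})$, the Waldspurger matrix $\mathbf{WT}(\pi)$ is the $(n-1)\times(n-1)$ matrix with $$\mathbf{WT}(\pi)_{i,j}=\begin{cases}\sum_{a\le i,\ b>j}\pi_{a,b} & i\le j,\\ \sum_{a>i,\ b\le j}\pi_{a,b} & i\ge j\end{cases}$$ (the formulas agree for $i=j$). A UM vector of length $n-1$ is any vector that appears as a column of $\mathbf{WT}(\pi)$ for some $\pi\in\mathfrak{S}_n$. A Motzkin path is a lattice path in $\mathbb{Z}\times\mathbb{Z}$ consisting of steps $(1,1)$, $(1,-1)$, $(1,0)$ which starts and ends on the $x$-axis but never passes below it (paths start at $(0,0)$, so a path with $n$ steps ends at $(n,0)$). It is unimodal if all occurrences of the step $(1,1)$ come before all occurrences of the step $(1,-1)$. *)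

theory Defs
  imports "Jordan_Normal_Form.Matrix" "HOL-Combinatorics.Permutations" "HOL-Library.Product_Plus"
begin

definition perm_matrix :: "(nat \<Rightarrow> nat) \<Rightarrow> nat \<Rightarrow> nat \<Rightarrow> nat" where
  "perm_matrix \<pi> a b = (if \<pi> a = b then 1 else 0)"

text \<open>Row and column indices are 1-based here; a permutation of size \<open>n\<close> is a function
  permuting \<open>{1..n}\<close>.\<close>

definition WT_entry :: "nat \<Rightarrow> (nat \<Rightarrow> nat) \<Rightarrow> nat \<Rightarrow> nat \<Rightarrow> nat" where
  "WT_entry n \<pi> i j =
     (if i \<le> j then (\<Sum>a\<in>{1..i}. \<Sum>b\<in>{j+1..n}. perm_matrix \<pi> a b)
      else (\<Sum>a\<in>{i+1..n}. \<Sum>b\<in>{1..j}. perm_matrix \<pi> a b))"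

text \<open>The second formula is also valid on the diagonal.\<close>

lemma WT_entry_ge:
  assumes "\<pi> permutes {1..n}" "j \<le> i" "i \<le> n"
  shows "WT_entry n \<pi> i j = (\<Sum>a\<in>{i+1..n}. \<Sum>b\<in>{1..j}. perm_matrix \<pi> a b)"
proof (cases "i = j")
  case False
  then show ?thesis using assms by (simp add: WT_entry_def)
next
  case True
  let ?p = "perm_matrix \<pi>" and ?L = "{1..i}" and ?H = "{i+1..n}"
  have split: "{1..n} = ?L \<union> ?H" "?L \<inter> ?H = {}" using assms(3) by auto
  have row: "(\<Sum>b\<in>{1..n}. ?p a b) = 1" if "a \<in> {1..n}" for a
    using that permutes_in_image[OF assms(1), of a] by (simp add: perm_matrix_def)
  have col: "(\<Sum>a\<in>{1..n}. ?p a b) = 1" if "b \<in> {1..n}" for b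
  proof -
    have "(\<pi> a = b) = (a = inv_into UNIV \<pi> b)" for a
      using permutes_inv_eq[OF assms(1), of b a] by auto
    then show ?thesis
      using that permutes_in_image[OF permutes_inv[OF assms(1)], of b]
      by (simp add: perm_matrix_def)
  qed
  have "(\<Sum>a\<in>?L. \<Sum>b\<in>?L. ?p a b) + (\<Sum>a\<in>?L. \<Sum>b\<in>?H. ?p a b) = (\<Sum>a\<in>?L. \<Sum>b\<in>{1..n}. ?p a b)"
    unfolding split(1) using split(2) by (simp add: sum.union_disjoint sum.distrib)
  also have "\<dots> = i" using assms(3) row by simp
  also have "i = (\<Sum>b\<in>?L. \<Sum>a\<in>{1..n}. ?p a b)" using assms(3) col by simp
  also have "\<dots> = (\<Sum>b\<in>?L. \<Sum>a\<in>?L. ?p a b) + (\<Sum>b\<in>?L. \<Sum>a\<in>?H. ?p a b)"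
    unfolding split(1) using split(2) by (simp add: sum.union_disjoint sum.distrib)
  also have "\<dots> = (\<Sum>a\<in>?L. \<Sum>b\<in>?L. ?p a b) + (\<Sum>a\<in>?H. \<Sum>b\<in>?L. ?p a b)"
    by (subst (1 2) sum.swap) simp
  finally show ?thesis using True by (simp add: WT_entry_def)
qed

text \<open>Matrices of type \<open>_ mat\<close> are indexed from 0, hence the shift.\<close>

definition WT :: "nat \<Rightarrow> (nat \<Rightarrow> nat) \<Rightarrow> nat mat" where
  "WT n \<pi> = mat (n - 1) (n - 1) (\<lambda>(i, j). WT_entry n \<pi> (i + 1) (j + 1))"

text \<open>The vectors of length \<open>m\<close> come from permutations of size \<open>m + 1\<close>.\<close>

definition UM_vectors :: "nat \<Rightarrow> nat vec set" where
  "UM_vectors m = {col (WT (m + 1) \<pi>) j | \<pi> j. \<pi> permutes {1..m + 1} \<and> j < m}"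

text \<open>A path starting at \<open>(0, 0)\<close> is given by its list of steps; the point reached after \<open>k\<close>
  steps is \<open>sum_list (take k p)\<close>.\<close>

definition motzkin_path :: "(int \<times> int) list \<Rightarrow> bool" where
  "motzkin_path p \<longleftrightarrow>
     set p \<subseteq> {(1, 1), (1, -1), (1, 0)} \<and>
     (\<forall>k\<le>length p. snd (sum_list (take k p)) \<ge> 0) \<and>
     snd (sum_list p) = 0"

definition unimodal_path :: "(int \<times> int) list \<Rightarrow> bool" where
  "unimodal_path p \<longleftrightarrow>
     (\<forall>i<length p. \<forall>j<length p. p ! i = (1, 1) \<and> p ! j = (1, -1) \<longrightarrow> i < j)"

definition unimodal_motzkin_paths :: "nat \<Rightarrow> (int \<times> int) list set" where
  "unimodal_motzkin_paths n = {p. length p = n \<and> motzkin_path p \<and> unimodal_path p}"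

end

theory Submission imports Defs begin

text \<open>
  Read down a column of \<open>WT n \<pi>\<close>, the column with 1-based index \<open>j\<close>. Down to row \<open>j\<close> the
  entry counts the rows seen so far whose value exceeds \<open>j\<close>; from row \<open>j\<close> on it counts the
  rows still to come whose value is at most \<open>j\<close>. So the entries grow by 0 or 1 as long as the
  row is at most \<open>j\<close> and then shrink by 0 or 1. Extended by a zero at either end they are the
  heights of a Motzkin path that has all its up steps among the first \<open>j\<close> steps and all its
  down steps after them. The step \<open>a\<close> fails to be level exactly when \<open>\<pi>\<close> carries \<open>a\<close> across
  the cut between \<open>j\<close> and \<open>j + 1\<close>.

  Both sides are therefore described by a set \<open>S\<close> of non-level steps together with a cut
  \<open>j\<close>, strictly inside the path, that has equally many elements of \<open>S\<close> on either side
  (\<open>balanced_cut\<close>). Every unimodal Motzkin path has this form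
  (\<open>unimodal_motzkin_paths_eq\<close>), and every balanced pair comes from a permutation, since the
  only obstruction to moving prescribed elements across the cut is that equally many have to go
  each way (\<open>displaced_surj\<close>). Hence the heights map the paths onto the UM vectors
  (\<open>UM_vectors_eq_heights\<close>), and they determine the path (\<open>inj_on_heights\<close>).

  For the count, two balanced cuts of the same \<open>S\<close> split \<open>S\<close> in the same way, so that the path is
  determined by \<open>S\<close> alone, and a balanced cut exists precisely when \<open>S\<close> has even size. A path with
  \<open>n + 1\<close> steps is thus the same as an even subset of a set with \<open>n + 1\<close> elements
  (\<open>bij_betw_support\<close>), and there are \<open>2 ^ n\<close> of those.
\<close>

section \<open>Unimodal Motzkin paths as sets with a balanced cut\<close>

abbreviation up :: "int \<times> int" where "up \<equiv> (1, 1)"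
abbreviation down :: "int \<times> int" where "down \<equiv> (1, -1)"
abbreviation level :: "int \<times> int" where "level \<equiv> (1, 0)"

definition marked_path :: "nat \<Rightarrow> nat set \<Rightarrow> nat \<Rightarrow> (int \<times> int) list" where
  "marked_path n S j =
     map (\<lambda>i. if i \<in> S then if i < j then up else down else level) [0..<n]"

text \<open>
  Steps are numbered from 0, so a cut \<open>j\<close> has \<open>j\<close> steps before it. Cuts at the two ends of the
  path are excluded because they do not correspond to columns of a matrix of size \<open>n - 1\<close>.
\<close>
definition balanced_cut :: "nat \<Rightarrow> nat set \<Rightarrow> nat \<Rightarrow> bool" where
  "balanced_cut n S j \<longleftrightarrow>
     S \<subseteq> {..<n} \<and> 0 < j \<and> j < n \<and> card (S \<inter> {..<j}) = card (S - {..<j})"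

definition support :: "(int \<times> int) list \<Rightarrow> nat set" where
  "support p = {i. i < length p \<and> p ! i \<noteq> level}"

text \<open>
  The two endpoints are left out: their height is zero on every Motzkin path, and UM vectors
  have one entry for each of the other points.
\<close>
definition heights :: "(int \<times> int) list \<Rightarrow> nat vec" where
  "heights p = vec (length p - 1) (\<lambda>i. nat (snd (sum_list (take (Suc i) p))))"

lemma length_marked_path [simp]: "length (marked_path n S j) = n"
  by (simp add: marked_path_def)

lemma nth_marked_path [simp]:
  "i < n \<Longrightarrow> marked_path n S j ! i = (if i \<in> S then if i < j then up else down else level)"
  by (simp add: marked_path_def)

lemma support_marked_path: "S \<subseteq> {..<n} \<Longrightarrow> support (marked_path n S j) = S"
  by (auto simp: support_def split: if_splits)

lemma set_marked_path: "set (marked_path n S j) \<subseteq> {up, down, level}"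
  by (auto simp: marked_path_def)

lemma height_Suc:
  assumes "k < length p"
  shows "snd (sum_list (take (Suc k) p)) = snd (sum_list (take k p)) + snd (p ! k)"
  using assms by (simp add: take_Suc_conv_app_nth)

lemma height_marked_path:
  assumes "k \<le> n"
  shows "snd (sum_list (take k (marked_path n S j))) =
         int (card (S \<inter> {..<min k j})) - int (card (S \<inter> {j..<k}))"
  using assms
proof (induction k)
  case (Suc k)
  have ins: "S \<inter> {..<Suc k} = (if k \<in> S then insert k (S \<inter> {..<k}) else S \<inter> {..<k})"
    "j \<le> k \<Longrightarrow> S \<inter> {j..<Suc k} = (if k \<in> S then insert k (S \<inter> {j..<k}) else S \<inter> {j..<k})"
    by (auto simp: less_Suc_eq)
  show ?case
  proof (cases "k < j")
    case True
    then have "min (Suc k) j = Suc k" "min k j = k" by auto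
    with Suc True ins(1) show ?thesis by (simp add: height_Suc)
  next
    case False
    then have "min (Suc k) j = j" "min k j = j" by auto
    with Suc False ins(2) show ?thesis by (simp add: height_Suc)
  qed
qed auto

lemma height_before_cut:
  assumes "balanced_cut n S j" "k \<le> j"
  shows "snd (sum_list (take k (marked_path n S j))) = int (card (S \<inter> {..<k}))"
  using assms by (simp add: height_marked_path balanced_cut_def min_def)

text \<open>
  Balance turns the number of up steps minus the number of down steps so far into the number of
  down steps still to come, which is also what a Waldspurger entry below the diagonal counts.
\<close>
lemma height_after_cut:
  assumes "balanced_cut n S j" "j \<le> k" "k \<le> n"
  shows "snd (sum_list (take k (marked_path n S j))) = int (card (S - {..<k}))"
proof -
  have S: "S \<subseteq> {..<n}" and bal: "card (S \<inter> {..<j}) = card (S - {..<j})"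
    using assms(1) by (auto simp: balanced_cut_def)
  have "S - {..<j} = S \<inter> {j..<k} \<union> (S - {..<k})" using assms(2) by auto
  moreover have "finite S" using S finite_subset by blast
  ultimately have "card (S - {..<j}) = card (S \<inter> {j..<k}) + card (S - {..<k})"
    using assms(2) by (simp only:) (rule card_Un_disjoint, auto)
  moreover have "min k j = j" using assms(2) by simp
  ultimately show ?thesis using assms(3) by (simp add: height_marked_path bal)
qed

lemma marked_path_unimodal_motzkin:
  assumes "balanced_cut n S j"
  shows "marked_path n S j \<in> unimodal_motzkin_paths n"
proof -
  let ?p = "marked_path n S j"
  have "snd (sum_list (take k ?p)) \<ge> 0" if "k \<le> n" for k
    using height_before_cut[OF assms, of k] height_after_cut[OF assms, of k] that
    by (cases "k \<le> j") auto
  moreover have "snd (sum_list ?p) = 0"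
  proof -
    have empty: "S - {..<n} = {}" and "j \<le> n" using assms by (auto simp: balanced_cut_def)
    then show ?thesis using height_after_cut[OF assms, of n] by (simp add: empty)
  qed
  moreover have "unimodal_path ?p"
    by (auto simp: unimodal_path_def split: if_splits)
  ultimately show ?thesis
    using set_marked_path by (auto simp: unimodal_motzkin_paths_def motzkin_path_def)
qed

text \<open>
  The cut can be placed directly after the last up step. It is then inside the path, because a
  path with an up step needs a later down step to return to the axis. A path without up steps
  consists of level steps only and any cut will do; the hypothesis \<open>n \<ge> 2\<close> provides one.
\<close>
lemma unimodal_motzkin_marked_path:
  assumes "p \<in> unimodal_motzkin_paths n" "n \<ge> 2"
  obtains j where "balanced_cut n (support p) j" "p = marked_path n (support p) j"
proof -
  have len: "length p = n" and steps: "set p \<subseteq> {up, down, level}"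
    and total: "snd (sum_list p) = 0" and uni: "unimodal_path p"
    using assms(1) by (auto simp: unimodal_motzkin_paths_def motzkin_path_def)
  have step: "p ! k \<in> {up, down, level}" if "k < n" for k
    using steps nth_mem[of k p] that len by blast
  define ups where "ups = {i. i < n \<and> p ! i = up}"
  define j where "j = (if ups = {} then 1 else Suc (Max ups))"
  have fin: "finite ups" by (simp add: ups_def)
  have before: "i < j" if "i < n" "p ! i = up" for i
  proof -
    have "i \<in> ups" using that by (simp add: ups_def)
    then show ?thesis using fin by (auto simp: j_def less_Suc_eq_le)
  qed
  have last_up: "j - 1 \<in> ups" if "ups \<noteq> {}"
    using that fin by (simp add: j_def)
  have after: "j \<le> i" if "i < n" "p ! i = down" for i
  proof (cases "ups = {}")
    case False
    then have "j - 1 < i"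
      using last_up that uni len by (auto simp: unimodal_path_def ups_def)
    then show ?thesis by simp
  next
    case True
    \<comment> \<open>Without an up step there is no down step either: the path would end below the axis.\<close>
    have le: "snd (p ! k) \<le> 0" if "k < n" for k
    proof -
      have "p ! k \<noteq> up" using True that by (auto simp: ups_def)
      then show ?thesis using step[OF that] by auto
    qed
    have "snd (sum_list p) = (\<Sum>k<n. snd (p ! k))"
      using len
    proof (induction p arbitrary: n rule: rev_induct)
      case (snoc x xs)
      then show ?case by (auto simp: nth_append)
    qed simp
    also have "\<dots> \<le> (\<Sum>k<n. if k = i then -1 else 0)"
      using le that by (intro sum_mono) auto
    also have "\<dots> = -1" using that by simp
    finally show ?thesis using total by simp
  qed
  let ?S = "support p"
  have S: "?S \<subseteq> {..<n}" using len by (auto simp: support_def)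
  have p: "p = marked_path n ?S j"
  proof (rule nth_equalityI)
    fix i assume "i < length p"
    then show "p ! i = marked_path n ?S j ! i"
      using step[of i] before[of i] after[of i] len by (auto simp: support_def)
  qed (simp add: len)
  have bal: "card (?S \<inter> {..<min n j}) = card (?S \<inter> {j..<n})"
    using height_marked_path[of n n ?S j] total len by (simp flip: p)
  have "j < n"
  proof (cases "ups = {}")
    case True
    then show ?thesis using assms(2) by (simp add: j_def)
  next
    case False
    have "finite ?S" by (simp add: support_def)
    moreover have "j - 1 \<in> ?S \<inter> {..<min n j}"
      using last_up[OF False] False len by (auto simp: ups_def support_def j_def)
    ultimately have "card (?S \<inter> {j..<n}) \<noteq> 0" by (auto simp flip: bal)
    then have "?S \<inter> {j..<n} \<noteq> {}" by auto
    then show ?thesis by auto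
  qed
  moreover have "j > 0" by (simp add: j_def)
  moreover have "?S \<inter> {j..<n} = ?S - {..<j}" using S by auto
  ultimately have "balanced_cut n ?S j"
    using bal S by (simp add: balanced_cut_def min_def)
  with p that show thesis by blast
qed

lemma unimodal_motzkin_paths_eq:
  assumes "n \<ge> 2"
  shows "unimodal_motzkin_paths n = {marked_path n S j | S j. balanced_cut n S j}"
proof (intro subset_antisym subsetI)
  fix p assume "p \<in> unimodal_motzkin_paths n"
  from unimodal_motzkin_marked_path[OF this assms]
  show "p \<in> {marked_path n S j | S j. balanced_cut n S j}" by blast
qed (auto intro: marked_path_unimodal_motzkin)

section \<open>Columns of the Waldspurger matrix as heights\<close>

text \<open>
  The positions that the permutation carries across the cut between \<open>j\<close> and \<open>j + 1\<close>, shifted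
  down by one so that they number the steps of a path.
\<close>
definition displaced :: "nat \<Rightarrow> (nat \<Rightarrow> nat) \<Rightarrow> nat \<Rightarrow> nat set" where
  "displaced n \<pi> j = {i. i < n \<and> (i < j) \<noteq> (\<pi> (Suc i) \<le> j)}"

lemma sum_perm_matrix_rows:
  assumes "finite A" "finite B"
  shows "(\<Sum>a\<in>A. \<Sum>b\<in>B. perm_matrix \<pi> a b) = card {a \<in> A. \<pi> a \<in> B}"
proof -
  have "(\<Sum>a\<in>A. \<Sum>b\<in>B. perm_matrix \<pi> a b) = (\<Sum>a\<in>A. if \<pi> a \<in> B then 1 else 0)"
    using assms(2) by (simp add: perm_matrix_def)
  also have "\<dots> = card {a \<in> A. \<pi> a \<in> B}"
    using assms(1) by (simp add: sum.If_cases Int_def)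
  finally show ?thesis .
qed

lemma WT_entry_above:
  assumes "\<pi> permutes {1..n}" "i \<le> j" "j \<le> n"
  shows "WT_entry n \<pi> i j = card (displaced n \<pi> j \<inter> {..<i})"
proof -
  have "{a \<in> {1..i}. \<pi> a \<in> {j+1..n}} = Suc ` (displaced n \<pi> j \<inter> {..<i})" (is "?L = ?R")
  proof
    show "?L \<subseteq> ?R"
    proof
      fix a assume a: "a \<in> ?L"
      then obtain b where "a = Suc b" by (cases a) auto
      with a show "a \<in> ?R" using assms by (auto simp: displaced_def)
    qed
    show "?R \<subseteq> ?L"
      using assms permutes_in_image[OF assms(1)] by (fastforce simp: displaced_def)
  qed
  then show ?thesis
    using assms by (simp only: WT_entry_def sum_perm_matrix_rows finite_atLeastAtMost)
      (simp add: card_image)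
qed

lemma WT_entry_below:
  assumes "\<pi> permutes {1..n}" "j \<le> i" "i \<le> n"
  shows "WT_entry n \<pi> i j = card (displaced n \<pi> j - {..<i})"
proof -
  have "{a \<in> {i+1..n}. \<pi> a \<in> {1..j}} = Suc ` (displaced n \<pi> j - {..<i})" (is "?L = ?R")
  proof
    show "?L \<subseteq> ?R"
    proof
      fix a assume a: "a \<in> ?L"
      then obtain b where "a = Suc b" by (cases a) auto
      with a show "a \<in> ?R" using assms by (auto simp: displaced_def)
    qed
    show "?R \<subseteq> ?L"
      using assms permutes_in_image[OF assms(1)] by (fastforce simp: displaced_def)
  qed
  then show ?thesis
    using assms by (simp only: WT_entry_ge sum_perm_matrix_rows finite_atLeastAtMost)
      (simp add: card_image)
qed

text \<open>
  On the diagonal both formulas for the Waldspurger entry apply; equating them says that as many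
  elements cross the cut upwards as downwards.
\<close>
lemma balanced_cut_displaced:
  assumes "\<pi> permutes {1..n}" "0 < j" "j < n"
  shows "balanced_cut n (displaced n \<pi> j) j"
proof -
  have "j \<le> n" using assms(3) by simp
  have "displaced n \<pi> j \<subseteq> {..<n}" by (auto simp: displaced_def)
  moreover have "card (displaced n \<pi> j \<inter> {..<j}) = card (displaced n \<pi> j - {..<j})"
    using WT_entry_above[OF assms(1) order_refl \<open>j \<le> n\<close>]
      WT_entry_below[OF assms(1) order_refl \<open>j \<le> n\<close>] by (rule trans[OF sym])
  ultimately show ?thesis using assms(2,3) by (simp add: balanced_cut_def)
qed

lemma col_WT:
  assumes "\<pi> permutes {1..n}" "0 < j" "j < n"
  shows "col (WT n \<pi>) (j - 1) = heights (marked_path n (displaced n \<pi> j) j)"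
proof (rule eq_vecI)
  fix i
  assume "i < dim_vec (heights (marked_path n (displaced n \<pi> j) j))"
  then have i: "Suc i < n" by (simp add: heights_def)
  have "col (WT n \<pi>) (j - 1) $ i = WT_entry n \<pi> (Suc i) j"
    using i assms by (simp add: WT_def)
  also have "\<dots> = heights (marked_path n (displaced n \<pi> j) j) $ i"
    using i assms balanced_cut_displaced[OF assms]
    by (cases "Suc i \<le> j")
      (simp_all add: heights_def WT_entry_above WT_entry_below
        height_before_cut height_after_cut)
  finally show "col (WT n \<pi>) (j - 1) $ i = heights (marked_path n (displaced n \<pi> j) j) $ i" .
next
  show "dim_vec (col (WT n \<pi>) (j - 1)) = dim_vec (heights (marked_path n (displaced n \<pi> j) j))"
    by (simp add: WT_def heights_def)
qed

lemma permutation_onto_initial_segment: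
  fixes A :: "nat set"
  assumes "A \<subseteq> {1..n}" "card A = j"
  obtains \<pi> where "\<pi> permutes {1..n}" "\<And>a. a \<in> {1..n} \<Longrightarrow> \<pi> a \<le> j \<longleftrightarrow> a \<in> A"
proof -
  have fin: "finite A" using assms(1) by (rule finite_subset) simp
  have "j \<le> n" using assms card_mono[OF _ assms(1)] by simp
  obtain f where f: "bij_betw f A {1..j}"
    using finite_same_card_bij[OF fin, of "{1..j}"] assms(2) by auto
  obtain g where g: "bij_betw g ({1..n} - A) {j+1..n}"
    using finite_same_card_bij[of "{1..n} - A" "{j+1..n}"] assms fin
    by (auto simp: card_Diff_subset)
  define \<pi> where "\<pi> a = (if a \<in> A then f a else if a \<in> {1..n} then g a else a)" for a
  have "bij_betw \<pi> A {1..j}" using f by (simp add: \<pi>_def cong: bij_betw_cong)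
  moreover have "bij_betw \<pi> ({1..n} - A) {j+1..n}"
    using g bij_betw_cong[of "{1..n} - A" \<pi> g] by (simp add: \<pi>_def)
  ultimately have "bij_betw \<pi> (A \<union> ({1..n} - A)) ({1..j} \<union> {j+1..n})"
    by (rule bij_betw_combine) auto
  moreover have "A \<union> ({1..n} - A) = {1..n}" "{1..j} \<union> {j+1..n} = {1..n}"
    using assms(1) \<open>j \<le> n\<close> by auto
  ultimately have "\<pi> permutes {1..n}"
    using assms(1) by (intro bij_imp_permutes) (auto simp: \<pi>_def)
  moreover have "\<pi> a \<le> j \<longleftrightarrow> a \<in> A" if "a \<in> {1..n}" for a
  proof (cases "a \<in> A")
    case True
    then show ?thesis using bij_betwE[OF f] by (auto simp: \<pi>_def)
  next
    case False
    then have "g a \<in> {j+1..n}" using bij_betwE[OF g] that by blast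
    with False that show ?thesis by (simp add: \<pi>_def)
  qed
  ultimately show thesis using that by blast
qed

text \<open>
  A permutation whose displaced set is \<open>S\<close> must send to \<open>{1..j}\<close> exactly the small positions outside
  \<open>S\<close> and the large positions in \<open>S\<close>. Balance of the cut makes these \<open>j\<close> positions in number, so
  that such a permutation exists.
\<close>
lemma displaced_surj:
  assumes "balanced_cut n S j"
  obtains \<pi> where "\<pi> permutes {1..n}" "displaced n \<pi> j = S"
proof -
  have S: "S \<subseteq> {..<n}" and j: "j < n" and bal: "card (S \<inter> {..<j}) = card (S - {..<j})"
    using assms by (auto simp: balanced_cut_def)
  have fin: "finite S" using S finite_subset by blast
  \<comment> \<open>the positions, counted from 0, that have to be sent to \<open>{1..j}\<close>\<close>
  define A where "A = ({..<j} - S) \<union> (S - {..<j})"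
  have "card A = card ({..<j} - S) + card (S - {..<j})"
    unfolding A_def using fin by (intro card_Un_disjoint) auto
  also have "\<dots> = card ({..<j} - S) + card ({..<j} \<inter> S)"
    using bal by (simp add: Int_commute)
  also have "\<dots> = j"
    using card_Int_Diff[of "{..<j}" S] by simp
  finally have "card (Suc ` A) = j" by (simp add: card_image)
  moreover have "Suc ` A \<subseteq> {1..n}" using S j by (auto simp: A_def)
  ultimately obtain \<pi> where \<pi>: "\<pi> permutes {1..n}"
      "\<And>a. a \<in> {1..n} \<Longrightarrow> \<pi> a \<le> j \<longleftrightarrow> a \<in> Suc ` A"
    using permutation_onto_initial_segment by metis
  have "\<pi> (Suc i) \<le> j \<longleftrightarrow> i \<in> A" if "i < n" for i
    using \<pi>(2)[of "Suc i"] that by (simp add: inj_image_mem_iff)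
  then have "displaced n \<pi> j = S"
    using S by (auto simp: displaced_def A_def)
  with \<pi>(1) that show thesis by blast
qed

lemma UM_vectors_eq_heights:
  assumes "n \<ge> 2"
  shows "UM_vectors (n - 1) = heights ` unimodal_motzkin_paths n"
proof -
  have "UM_vectors (n - 1) = {col (WT n \<pi>) j | \<pi> j. \<pi> permutes {1..n} \<and> j < n - 1}"
    using assms by (simp add: UM_vectors_def)
  also have "\<dots> = {col (WT n \<pi>) (j - 1) | \<pi> j. \<pi> permutes {1..n} \<and> 0 < j \<and> j < n}"
  proof (intro Collect_cong iffI; elim exE conjE)
    fix v \<pi> j assume "v = col (WT n \<pi>) j" "\<pi> permutes {1..n}" "j < n - 1"
    then show "\<exists>\<pi> j. v = col (WT n \<pi>) (j - 1) \<and> \<pi> permutes {1..n} \<and> 0 < j \<and> j < n"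
      by (intro exI[of _ \<pi>] exI[of _ "Suc j"]) auto
  next
    fix v \<pi> and j :: nat
    assume "v = col (WT n \<pi>) (j - 1)" "\<pi> permutes {1..n}" "0 < j" "j < n"
    then show "\<exists>\<pi> j. v = col (WT n \<pi>) j \<and> \<pi> permutes {1..n} \<and> j < n - 1"
      by (intro exI[of _ \<pi>] exI[of _ "j - 1"]) auto
  qed
  also have "\<dots> = {heights (marked_path n (displaced n \<pi> j) j) | \<pi> j.
      \<pi> permutes {1..n} \<and> 0 < j \<and> j < n}"
    using col_WT by (intro Collect_cong) metis
  also have "\<dots> = {heights (marked_path n S j) | S j. balanced_cut n S j}"
    using balanced_cut_displaced displaced_surj
    by (intro Collect_cong) (metis balanced_cut_def)
  also have "\<dots> = heights ` unimodal_motzkin_paths n"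
    using unimodal_motzkin_paths_eq[OF assms] by auto
  finally show ?thesis .
qed

text \<open>
  Every step has horizontal part 1, so a path is determined by its heights. Truncating a height
  to a natural number loses nothing because Motzkin paths stay above the axis.
\<close>
lemma inj_on_heights: "inj_on heights (unimodal_motzkin_paths n)"
proof (rule inj_onI)
  fix p q
  assume pq: "p \<in> unimodal_motzkin_paths n" "q \<in> unimodal_motzkin_paths n"
    and eq: "heights p = heights q"
  let ?h = "\<lambda>p k. snd (sum_list (take k p))"
  have p: "length p = n" "set p \<subseteq> {up, down, level}" "\<And>k. k \<le> n \<Longrightarrow> ?h p k \<ge> 0" "?h p n = 0"
    and q: "length q = n" "set q \<subseteq> {up, down, level}" "\<And>k. k \<le> n \<Longrightarrow> ?h q k \<ge> 0" "?h q n = 0"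
    using pq by (auto simp: unimodal_motzkin_paths_def motzkin_path_def)
  have h: "?h p k = ?h q k" if "k \<le> n" for k
  proof (cases "k = 0 \<or> k = n")
    case True
    then show ?thesis using p(4) q(4) by auto
  next
    case False
    define i where "i = k - 1"
    have i: "k = Suc i" "i < n - 1" using False that by (auto simp: i_def)
    have "nat (?h p k) = nat (?h q k)"
      using arg_cong[OF eq, of "\<lambda>v. v $ i"] i p(1) q(1) by (simp add: heights_def)
    then show ?thesis using p(3) q(3) that by (metis int_nat_eq)
  qed
  show "p = q"
  proof (rule nth_equalityI)
    fix i assume "i < length p"
    then have i: "i < n" using p(1) by simp
    then have "snd (p ! i) = snd (q ! i)"
      using h[of i] h[of "Suc i"] height_Suc[of i p] height_Suc[of i q] p(1) q(1) by simp
    moreover have "p ! i \<in> {up, down, level}"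
      by (rule subsetD[OF p(2)]) (simp add: p(1) i)
    moreover have "q ! i \<in> {up, down, level}"
      by (rule subsetD[OF q(2)]) (simp add: q(1) i)
    ultimately show "p ! i = q ! i"
      by (elim insertE emptyE) simp_all
  qed (simp add: p(1) q(1))
qed

section \<open>Counting unimodal Motzkin paths\<close>

text \<open>
  All balanced cuts of \<open>S\<close> have exactly half of \<open>S\<close> before them, so no element of \<open>S\<close> can
  lie between two of them.
\<close>
lemma balanced_cut_not_between:
  assumes "balanced_cut n S j" "balanced_cut n S j'" "i \<in> S" "i < j"
  shows "i < j'"
proof (rule ccontr)
  assume "\<not> i < j'"
  have half: "2 * card (S \<inter> {..<k}) = card S" if "balanced_cut n S k" for k
    using that card_Int_Diff[of S "{..<k}"] finite_subset[of S "{..<n}"]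
    by (simp add: balanced_cut_def)
  have "S \<inter> {..<j'} \<subset> S \<inter> {..<j}" using assms(3,4) \<open>\<not> i < j'\<close> by auto
  then have "card (S \<inter> {..<j'}) < card (S \<inter> {..<j})" by (intro psubset_card_mono) auto
  with half[OF assms(1)] half[OF assms(2)] show False by simp
qed

text \<open>
  Moving the cut by one position changes the number of elements of \<open>S\<close> before it by at most one.
  On its way from 0 to \<open>card S\<close> this number passes through \<open>card S div 2\<close>, and if \<open>S\<close> is not
  empty this happens neither at the start nor at the end.
\<close>
lemma ex_balanced_cut_iff:
  assumes "S \<subseteq> {..<n}" "n \<ge> 2"
  shows "(\<exists>j. balanced_cut n S j) \<longleftrightarrow> even (card S)"
proof
  have fin: "finite S" using assms(1) finite_subset by blast
  note split = card_Int_Diff[OF fin]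
  show "even (card S)" if "\<exists>j. balanced_cut n S j"
  proof -
    from that obtain j where "balanced_cut n S j" ..
    then have "card S = 2 * card (S - {..<j})"
      using split[of "{..<j}"] by (simp add: balanced_cut_def)
    then show ?thesis by simp
  qed
  show "\<exists>j. balanced_cut n S j" if "even (card S)"
  proof (cases "S = {}")
    case True
    then show ?thesis using assms(2) by (intro exI[of _ 1]) (simp add: balanced_cut_def)
  next
    case False
    then have pos: "card S > 0" using fin by (simp add: card_gt_0_iff)
    let ?f = "\<lambda>k. int (card (S \<inter> {..<k}))"
    have "\<bar>?f (i + 1) - ?f i\<bar> \<le> 1" for i
    proof -
      have "S \<inter> {..<Suc i} = (if i \<in> S then insert i (S \<inter> {..<i}) else S \<inter> {..<i})"
        by (auto simp: less_Suc_eq)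
      then show ?thesis by simp
    qed
    moreover have Sn: "S \<inter> {..<n} = S" using assms(1) by auto
    ultimately obtain j where j: "j \<le> n" "?f j = int (card S div 2)"
      using nat0_intermed_int_val[of n ?f "int (card S div 2)"] by auto
    have bal: "2 * card (S \<inter> {..<j}) = card S" using j(2) that by simp
    have "j \<noteq> 0"
    proof
      assume "j = 0"
      with bal pos show False by simp
    qed
    moreover have "j \<noteq> n"
    proof
      assume "j = n"
      with bal pos Sn show False by simp
    qed
    ultimately show ?thesis
      using j(1) bal split[of "{..<j}"] assms(1)
      by (intro exI[of _ j]) (simp add: balanced_cut_def)
  qed
qed

lemma bij_betw_support:
  assumes "n \<ge> 2"
  shows "bij_betw support (unimodal_motzkin_paths n) {S. S \<subseteq> {..<n} \<and> even (card S)}"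
proof (rule bij_betw_imageI)
  show "inj_on support (unimodal_motzkin_paths n)"
  proof (rule inj_onI)
    fix p q
    assume "p \<in> unimodal_motzkin_paths n" "q \<in> unimodal_motzkin_paths n"
      and eq: "support p = support q"
    then obtain j j' where
      j: "balanced_cut n (support p) j" "p = marked_path n (support p) j" and
      j': "balanced_cut n (support p) j'" "q = marked_path n (support p) j'"
      using unimodal_motzkin_marked_path[OF _ assms] by metis
    then have "i < j \<longleftrightarrow> i < j'" if "i \<in> support p" for i
      using balanced_cut_not_between that by blast
    then have "marked_path n (support p) j = marked_path n (support p) j'"
      by (auto simp: marked_path_def)
    then show "p = q" using j(2) j'(2) by simp
  qed
  have "support ` unimodal_motzkin_paths n = {S. \<exists>j. balanced_cut n S j}"
  proof (intro subset_antisym subsetI)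
    fix S assume "S \<in> support ` unimodal_motzkin_paths n"
    then show "S \<in> {S. \<exists>j. balanced_cut n S j}"
      using unimodal_motzkin_marked_path[OF _ assms] by blast
  next
    fix S assume "S \<in> {S. \<exists>j. balanced_cut n S j}"
    then obtain j where j: "balanced_cut n S j" by blast
    then have "support (marked_path n S j) = S"
      by (simp add: balanced_cut_def support_marked_path)
    with marked_path_unimodal_motzkin[OF j]
    show "S \<in> support ` unimodal_motzkin_paths n" by (metis imageI)
  qed
  also have "\<dots> = {S. S \<subseteq> {..<n} \<and> even (card S)}"
    using ex_balanced_cut_iff[OF _ assms] by (auto simp: balanced_cut_def)
  finally show "support ` unimodal_motzkin_paths n = {S. S \<subseteq> {..<n} \<and> even (card S)}" .
qed

lemma card_even_subsets:
  assumes "finite A" "A \<noteq> {}"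
  shows "card {S. S \<subseteq> A \<and> even (card S)} = 2 ^ (card A - 1)"
proof -
  let ?E = "{S. S \<subseteq> A \<and> even (card S)}" and ?O = "{S. S \<subseteq> A \<and> odd (card S)}"
  have fin: "finite ?E" "finite ?O" using assms(1) by auto
  have "2 * card ?E = card ?E + card ?O"
    using card_subsupersets_even_odd[of A "{}"] assms by auto
  also have "\<dots> = card (?E \<union> ?O)"
    using fin by (intro card_Un_disjoint[symmetric]) auto
  also have "?E \<union> ?O = Pow A" by auto
  also have "card (Pow A) = 2 * 2 ^ (card A - 1)"
    using assms by (simp add: card_Pow card_gt_0_iff flip: power_Suc)
  finally show ?thesis by simp
qed

theorem theorem5:
  "(\<forall>n\<ge>2. \<exists>f. bij_betw f (UM_vectors (n - 1)) (unimodal_motzkin_paths n)) \<and>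
   (\<forall>n\<ge>1. card (UM_vectors n) = 2 ^ n)"
proof (intro conjI allI impI)
  have heights: "bij_betw heights (unimodal_motzkin_paths n) (UM_vectors (n - 1))"
    if "n \<ge> 2" for n
    by (intro bij_betw_imageI inj_on_heights UM_vectors_eq_heights[OF that, symmetric])
  show "\<exists>f. bij_betw f (UM_vectors (n - 1)) (unimodal_motzkin_paths n)" if "n \<ge> 2" for n
    using bij_betw_inv[OF heights[OF that]] .
  show "card (UM_vectors n) = 2 ^ n" if "n \<ge> 1" for n
  proof -
    have n: "Suc n \<ge> 2" using that by simp
    have "card (UM_vectors n) = card (unimodal_motzkin_paths (Suc n))"
      using bij_betw_same_card[OF heights[OF n]] by simp
    also have "\<dots> = card {S. S \<subseteq> {..<Suc n} \<and> even (card S)}"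
      using bij_betw_same_card[OF bij_betw_support[OF n]] .
    also have "\<dots> = 2 ^ n"
      using card_even_subsets[of "{..<Suc n}"] by auto
    finally show ?thesis .
  qed
qed

end
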